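(* Let $\lambda=[\lambda_1,\ldots,\lambda_k]$ be a partition with frequency representation $[a_1,\ldots,a_{\lambda_1}]$, let $n$ be a positive integer, and let $v=(v_1<\cdots<v_k)$ be a strictly increasing vector of length $k$ with entries in $\{1,\ldots,n\}$. Then $P(v,\lambda,n)$ consists exactly of all real $\lambda_1\times n$ matrices $X=(X_{ij})$ such that (i) $0\le\sum_{i'=1}^{i}X_{i'j}\le 1$ for all $1\le i\le\lambda_1$, $1\le j\le n$; (ii) $0\le\sum_{j'=1}^{j}X_{ij'}$ for all $1\le i\le\lambda_1$, $1\le j\le n$; (iii) $\sum_{j'=1}^{n}X_{ij'}=a_{\lambda_1-i+1}$ for all $1\le i\le\lambda_1$; (iv) $\sum_{i'=1}^{\lambda_1}X_{i'j}=1$ if $j$ is an entry of $v$, and $=0$ otherwise, for $1\le j\le n$.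
   Context: A partition $\lambda=[\lambda_1,\ldots,\lambda_k]$ is a weakly decreasing sequence of positive integers; $k$ is its length; $a_i$ is the number of parts equal to $i$. A sign matrix is a matrix with entries in $\{-1,0,1\}$ all of whose column partial sums from the top lie in $\{0,1\}$ and all of whose row partial sums from the left are nonnegative. $M(\lambda,n)$ is the set of $\lambda_1\times n$ sign matrices whose $i$-th row sums to $a_{\lambda_1-i+1}$ for all $i$. $M(v,\lambda,n)$ is the set of $M\in M(\lambda,n)$ such that the $j$-th column of $M$ sums to $1$ if $j$ is an entry of $v$ and to $0$ otherwise. $P(v,\lambda,n)$ is the convex hull of $M(v,\lambda,n)$ in $\mathbb{R}^{\lambda_1 n}$. *)

theory Defs
  imports "HOL-Analysis.Finite_Function_Topology" "HOL-Analysis.Convex"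
begin

text \<open>
  Since the size of a matrix depends on the partition, the space of real \<open>m \<times> n\<close> matrices
  is rendered as the subspace of those finitely supported functions on pairs of naturals whose
  support lies in \<open>{1..m} \<times> {1..n}\<close>. Rows and columns are numbered from 1, from the top and
  from the left. The finitely supported functions form a real vector space, so the library's
  convex hull applies.
\<close>

type_synonym rmatrix = "(nat \<times> nat) \<Rightarrow>\<^sub>0 real"

abbreviation entry :: "rmatrix \<Rightarrow> nat \<Rightarrow> nat \<Rightarrow> real" where
  "entry X i j \<equiv> Poly_Mapping.lookup X (i, j)"

definition matrices :: "nat \<Rightarrow> nat \<Rightarrow> rmatrix set" where
  "matrices m n = {X. Poly_Mapping.keys X \<subseteq> {1..m} \<times> {1..n}}"

definition is_partition :: "nat list \<Rightarrow> bool" where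
  "is_partition lam \<longleftrightarrow> sorted_wrt (\<ge>) lam \<and> (\<forall>p \<in> set lam. 0 < p)"

text \<open>The value 0 for the empty partition is a convention.\<close>

definition first_part :: "nat list \<Rightarrow> nat" where
  "first_part lam = (case lam of [] \<Rightarrow> 0 | p # _ \<Rightarrow> p)"

definition freq :: "nat list \<Rightarrow> nat \<Rightarrow> nat" where
  "freq lam i = count_list lam i"

definition sign_matrices :: "nat \<Rightarrow> nat \<Rightarrow> rmatrix set" where
  "sign_matrices m n = {X \<in> matrices m n. \<forall>i \<in> {1..m}. \<forall>j \<in> {1..n}.
     entry X i j \<in> {-1, 0, 1} \<and>
     (\<Sum>i' = 1..i. entry X i' j) \<in> {0, 1} \<and>
     0 \<le> (\<Sum>j' = 1..j. entry X i j')}"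

definition partition_sign_matrices :: "nat list \<Rightarrow> nat \<Rightarrow> rmatrix set" where
  "partition_sign_matrices lam n = {X \<in> sign_matrices (first_part lam) n.
     \<forall>i \<in> {1..first_part lam}.
       (\<Sum>j = 1..n. entry X i j) = real (freq lam (first_part lam - i + 1))}"

definition column_sign_matrices :: "nat list \<Rightarrow> nat list \<Rightarrow> nat \<Rightarrow> rmatrix set" where
  "column_sign_matrices v lam n = {X \<in> partition_sign_matrices lam n.
     \<forall>j \<in> {1..n}. (\<Sum>i = 1..first_part lam. entry X i j) = (if j \<in> set v then 1 else 0)}"

definition column_polytope :: "nat list \<Rightarrow> nat list \<Rightarrow> nat \<Rightarrow> rmatrix set" where
  "column_polytope v lam n = convex hull (column_sign_matrices v lam n)"

end

theory Submission
  imports Defs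
begin

text \<open>
  A matrix is encoded by its corner sums \<open>S i j\<close>, the sums over the upper left \<open>i \<times> j\<close> blocks.
  Conditions (i) and (ii) say that \<open>0 \<le> S i j - S i (j - 1) \<le> 1\<close> and that \<open>S i j\<close> increases
  with \<open>i\<close>; (iii) and (iv) fix integral values of \<open>S\<close> along the boundary. For every shift
  \<open>t \<in> [0, 1)\<close> the rounded array \<open>\<lfloor>S i j + t\<rfloor>\<close> satisfies the same conditions, so it is the
  corner sum array of a sign matrix with the same row and column sums. The average of
  \<open>\<lfloor>x + t\<rfloor>\<close> over \<open>t\<close> is \<open>x\<close>, and for finitely many \<open>x\<close> the average is attained by finitely
  many weighted shifts; this writes the given matrix as a convex combination of sign matrices.
\<close>

section \<open>Finite weights that average out rounding\<close>

text \<open>A discrete stand-in for length on \<open>[b, 1]\<close>: each point of \<open>B\<close>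
  carries the gap to the next larger point, the largest one the gap to 1, so the tails
  telescope.\<close>

lemma ex_upper_tail_weights:
  fixes B :: "real set"
  assumes "finite B" and "B \<subseteq> {..1}"
  shows "\<exists>w. (\<forall>t. 0 \<le> w t) \<and> (\<forall>b\<in>B. (\<Sum>t\<in>{t\<in>B. b \<le> t}. w t) = 1 - b)"
  using assms
proof (induction B rule: finite_linorder_min_induct)
  case empty
  show ?case by (rule exI[of _ "\<lambda>_. 0"]) simp
next
  case (insert b B)
  then have "B \<subseteq> {..1}" by simp
  with insert.IH obtain w where nonneg: "\<And>t. 0 \<le> w t"
    and tail: "\<And>x. x \<in> B \<Longrightarrow> (\<Sum>t\<in>{t\<in>B. x \<le> t}. w t) = 1 - x"
    by blast
  \<comment> \<open>This makes the weight given to the new minimum \<open>b\<close>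
    nonnegative.\<close>
  have total: "sum w B \<le> 1 - b"
  proof (cases "B = {}")
    case True
    with insert.prems show ?thesis by simp
  next
    case False
    then have "{t\<in>B. Min B \<le> t} = B" "Min B \<in> B" using insert.hyps by auto
    then show ?thesis using tail[of "Min B"] insert.hyps by force
  qed
  have b: "b \<notin> B" using insert.hyps by auto
  define w' where "w' = w(b := 1 - b - sum w B)"
  have w'_B: "sum w' A = sum w A" if "A \<subseteq> B" for A
    using b that by (intro sum.cong) (auto simp: w'_def)
  have "(\<Sum>t\<in>{t \<in> insert b B. x \<le> t}. w' t) = 1 - x" if "x \<in> insert b B" for x
  proof (cases "x = b")
    case True
    then have "{t \<in> insert b B. x \<le> t} = insert b B" using insert.hyps by force
    then show ?thesis using b insert.hyps True w'_B[of B] by (simp add: w'_def)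
  next
    case False
    then have "{t \<in> insert b B. x \<le> t} = {t\<in>B. x \<le> t}" "x \<in> B"
      using insert.hyps that by force+
    then show ?thesis using tail w'_B[of "{t\<in>B. x \<le> t}"] by auto
  qed
  moreover have "0 \<le> w' t" for t using nonneg total by (simp add: w'_def)
  ultimately show ?case by blast
qed

text \<open>As \<open>t\<close> runs through \<open>[0, 1)\<close>, the floor starts at
  \<open>x - frac x\<close> and, for non-integral \<open>x\<close>, jumps once, by 1, at the
  threshold \<open>1 - frac x\<close>.\<close>

lemma floor_add_shift:
  fixes x t :: real
  assumes "0 \<le> t" and "t < 1"
  shows "real_of_int \<lfloor>x + t\<rfloor> =
    x - frac x + (if 0 < frac x \<and> 1 - frac x \<le> t then 1 else 0)"
proof -
  have "\<lfloor>x + t\<rfloor> = \<lfloor>x\<rfloor> + (if 1 \<le> frac x + t then 1 else 0)"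
    using assms unfolding frac_def by (simp split: if_split) linarith
  then show ?thesis using assms by (auto simp: frac_def)
qed

text \<open>Only the jump thresholds matter as shifts: the tail from \<open>1 - frac x\<close>
  weighs \<open>frac x\<close>, exactly what the floor of \<open>x\<close> lacks.\<close>

lemma ex_rounding_weights:
  fixes A :: "real set"
  assumes "finite A"
  shows "\<exists>T w. finite T \<and> T \<subseteq> {0..<1} \<and> (\<forall>t\<in>T. 0 \<le> w t) \<and> sum w T = 1 \<and>
    (\<forall>x\<in>A. (\<Sum>t\<in>T. w t * real_of_int \<lfloor>x + t\<rfloor>) = x)"
proof -
  \<comment> \<open>The point 0 makes the tail from 0 the total weight 1. Integral \<open>x\<close>
    would give the threshold 1, outside \<open>[0, 1)\<close>.\<close>
  define T where "T = insert 0 ((\<lambda>x. 1 - frac x) ` {x\<in>A. 0 < frac x})"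
  have fin: "finite T" using assms by (simp add: T_def)
  have T: "T \<subseteq> {0..<1}"
    using less_imp_le[OF frac_lt_1] by (auto simp: T_def)
  then have "T \<subseteq> {..1}" by auto
  from ex_upper_tail_weights[OF fin this] obtain w where w: "\<And>t. 0 \<le> w t"
    and tail: "\<And>b. b \<in> T \<Longrightarrow> (\<Sum>t\<in>{t\<in>T. b \<le> t}. w t) = 1 - b"
    by auto
  have "{t\<in>T. 0 \<le> t} = T" "0 \<in> T" using T by (auto simp: T_def)
  then have total: "sum w T = 1" using tail[of 0] by simp
  have "(\<Sum>t\<in>T. w t * real_of_int \<lfloor>x + t\<rfloor>) = x" if "x \<in> A" for x
  proof -
    define q where "q \<longleftrightarrow> 0 < frac x"
    have "(\<Sum>t\<in>T. w t * real_of_int \<lfloor>x + t\<rfloor>) =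
        (\<Sum>t\<in>T. w t * (x - frac x) + (if q \<and> 1 - frac x \<le> t then w t else 0))"
      using T by (intro sum.cong refl, subst floor_add_shift) (auto simp: q_def algebra_simps)
    also have "\<dots> = (x - frac x) + (\<Sum>t\<in>T. if q \<and> 1 - frac x \<le> t then w t else 0)"
      using total by (simp add: sum.distrib flip: sum_distrib_right)
    also have "(\<Sum>t\<in>T. if q \<and> 1 - frac x \<le> t then w t else 0) = frac x"
    proof (cases q)
      case True
      then have "1 - frac x \<in> T" using that by (auto simp: T_def q_def)
      then show ?thesis using True tail[of "1 - frac x"] fin
        by (simp add: sum.inter_filter[symmetric])
    next
      case False
      then show ?thesis using frac_ge_0[of x] by (simp add: q_def)
    qed
    finally show ?thesis by simp
  qed
  with fin T w total show ?thesis by blast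
qed

section \<open>Corner sums and their inversion\<close>

definition corner_sum :: "rmatrix \<Rightarrow> nat \<Rightarrow> nat \<Rightarrow> real" where
  "corner_sum X i j = (\<Sum>i' = 1..i. \<Sum>j' = 1..j. entry X i' j')"

lemma corner_sum_0 [simp]: "corner_sum X 0 j = 0" "corner_sum X i 0 = 0"
  by (simp_all add: corner_sum_def)

lemma corner_sum_Suc_row:
  "corner_sum X (Suc i) j = corner_sum X i j + (\<Sum>j' = 1..j. entry X (Suc i) j')"
  by (simp add: corner_sum_def)

lemma corner_sum_Suc_col:
  "corner_sum X i (Suc j) = corner_sum X i j + (\<Sum>i' = 1..i. entry X i' (Suc j))"
  by (simp add: corner_sum_def sum.distrib)

text \<open>Inverts the passage to corner sums for arrays that vanish in row 0 and column 0. The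
  cut-off outside the rectangle keeps the support finite.\<close>

definition mixed_difference :: "nat \<Rightarrow> nat \<Rightarrow> (nat \<Rightarrow> nat \<Rightarrow> real) \<Rightarrow> rmatrix" where
  "mixed_difference m n F = Abs_poly_mapping (\<lambda>(i, j).
     if i \<in> {1..m} \<and> j \<in> {1..n}
     then (F i j - F i (j - 1)) - (F (i - 1) j - F (i - 1) (j - 1)) else 0)"

lemma entry_mixed_difference:
  "entry (mixed_difference m n F) i j =
    (if i \<in> {1..m} \<and> j \<in> {1..n}
     then (F i j - F i (j - 1)) - (F (i - 1) j - F (i - 1) (j - 1)) else 0)"
proof -
  have "finite {p. (case p of (i, j) \<Rightarrow> if i \<in> {1..m} \<and> j \<in> {1..n}
      then (F i j - F i (j - 1)) - (F (i - 1) j - F (i - 1) (j - 1)) else 0) \<noteq> 0}"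
    by (rule finite_subset[of _ "{1..m} \<times> {1..n}"]) (auto split: if_splits)
  then show ?thesis unfolding mixed_difference_def by (subst lookup_Abs_poly_mapping) auto
qed

lemma mixed_difference_in_matrices: "mixed_difference m n F \<in> matrices m n"
  by (auto simp: matrices_def in_keys_iff entry_mixed_difference split: if_splits)

lemma mixed_difference_col_sum:
  assumes "i \<le> m" and "j \<in> {1..n}"
  shows "(\<Sum>i' = 1..i. entry (mixed_difference m n F) i' j) =
    (F i j - F i (j - 1)) - (F 0 j - F 0 (j - 1))"
  using assms by (induction i) (simp_all add: entry_mixed_difference)

lemma mixed_difference_row_sum:
  assumes "i \<in> {1..m}" and "j \<le> n"
  shows "(\<Sum>j' = 1..j. entry (mixed_difference m n F) i j') =
    (F i j - F (i - 1) j) - (F i 0 - F (i - 1) 0)"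
  using assms(2) assms(1) by (induction j) (simp_all add: entry_mixed_difference)

lemma mixed_difference_corner_sum:
  assumes "X \<in> matrices m n"
  shows "mixed_difference m n (corner_sum X) = X"
proof (rule poly_mapping_eqI)
  fix p :: "nat \<times> nat"
  obtain i j where p: "p = (i, j)" by (cases p)
  show "Poly_Mapping.lookup (mixed_difference m n (corner_sum X)) p = Poly_Mapping.lookup X p"
  proof (cases "i \<in> {1..m} \<and> j \<in> {1..n}")
    case True
    \<comment> \<open>Column differences of corner sums are column partial sums, and those of rows
      \<open>i'\<close> and \<open>Suc i'\<close> differ by a single entry.\<close>
    then obtain i' j' where "i = Suc i'" "j = Suc j'"
      by (metis Suc_pred' atLeastAtMost_iff less_eq_Suc_le One_nat_def)
    with True show ?thesis
      by (simp add: p entry_mixed_difference corner_sum_Suc_col)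
  next
    case False
    then have "(i, j) \<notin> Poly_Mapping.keys X" using assms by (auto simp: matrices_def)
    with False show ?thesis by (auto simp: p entry_mixed_difference in_keys_iff)
  qed
qed

lemma lookup_scaleR:
  fixes f :: "'a \<Rightarrow>\<^sub>0 real"
  shows "Poly_Mapping.lookup (a *\<^sub>R f) k = a * Poly_Mapping.lookup f k"
proof -
  have "{x. a *\<^sub>R Poly_Mapping.lookup f x \<noteq> 0} \<subseteq> Poly_Mapping.keys f"
    by (auto simp: in_keys_iff)
  then have "finite {x. a *\<^sub>R Poly_Mapping.lookup f x \<noteq> 0}"
    by (rule finite_subset) simp
  then show ?thesis by (simp add: scaleR_poly_mapping_def)
qed

text \<open>By linearity, averaging corner sum arrays amounts to averaging matrices.\<close>

lemma mixed_difference_sum: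
  "mixed_difference m n (\<lambda>i j. \<Sum>t\<in>T. w t * F t i j) =
    (\<Sum>t\<in>T. w t *\<^sub>R mixed_difference m n (F t))"
proof (rule poly_mapping_eqI)
  fix p :: "nat \<times> nat"
  show "Poly_Mapping.lookup (mixed_difference m n (\<lambda>i j. \<Sum>t\<in>T. w t * F t i j)) p =
    Poly_Mapping.lookup (\<Sum>t\<in>T. w t *\<^sub>R mixed_difference m n (F t)) p"
    by (cases p; cases "p \<in> {1..m} \<times> {1..n}")
      (auto simp: lookup_sum lookup_scaleR entry_mixed_difference
        sum_subtractf right_diff_distrib intro!: sum.neutral)
qed

section \<open>Sign matrices with prescribed row and column sums\<close>

text \<open>The margins are arbitrary but of type \<open>int\<close>: integrality is what lets them
  survive rounding.\<close>

definition margin_sign_matrices ::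
    "nat \<Rightarrow> nat \<Rightarrow> (nat \<Rightarrow> int) \<Rightarrow> (nat \<Rightarrow> int) \<Rightarrow> rmatrix set" where
  "margin_sign_matrices m n r c = {X \<in> sign_matrices m n.
     (\<forall>i \<in> {1..m}. (\<Sum>j = 1..n. entry X i j) = r i) \<and>
     (\<forall>j \<in> {1..n}. (\<Sum>i = 1..m. entry X i j) = c j)}"

definition margin_polytope ::
    "nat \<Rightarrow> nat \<Rightarrow> (nat \<Rightarrow> int) \<Rightarrow> (nat \<Rightarrow> int) \<Rightarrow> rmatrix set" where
  "margin_polytope m n r c = {X \<in> matrices m n.
     (\<forall>i \<in> {1..m}. \<forall>j \<in> {1..n}.
        0 \<le> (\<Sum>i' = 1..i. entry X i' j) \<and> (\<Sum>i' = 1..i. entry X i' j) \<le> 1) \<and>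
     (\<forall>i \<in> {1..m}. \<forall>j \<in> {1..n}. 0 \<le> (\<Sum>j' = 1..j. entry X i j')) \<and>
     (\<forall>i \<in> {1..m}. (\<Sum>j' = 1..n. entry X i j') = r i) \<and>
     (\<forall>j \<in> {1..n}. (\<Sum>i' = 1..m. entry X i' j) = c j)}"

lemma convex_margin_polytope: "convex (margin_polytope m n r c)"
proof (rule convexI)
  fix X Y and a b :: real
  assume X: "X \<in> margin_polytope m n r c" and Y: "Y \<in> margin_polytope m n r c"
    and ab: "0 \<le> a" "0 \<le> b" "a + b = 1"
  have entry: "entry (a *\<^sub>R X + b *\<^sub>R Y) i j = a * entry X i j + b * entry Y i j" for i j
    by (simp add: lookup_add lookup_scaleR)
  have lin: "(\<Sum>k\<in>K. a * f k + b * g k) = a * sum f K + b * sum g K"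
    for f g :: "nat \<Rightarrow> real" and K
    by (simp add: sum.distrib sum_distrib_left)
  have "Poly_Mapping.keys (a *\<^sub>R X + b *\<^sub>R Y) \<subseteq> Poly_Mapping.keys X \<union> Poly_Mapping.keys Y"
    by (auto simp: in_keys_iff lookup_add lookup_scaleR)
  then have "a *\<^sub>R X + b *\<^sub>R Y \<in> matrices m n"
    using X Y by (auto simp: margin_polytope_def matrices_def)
  moreover have "a * x + b * y \<le> 1" if "x \<le> 1" "y \<le> 1" for x y :: real
    using convex_bound_le[OF that ab] .
  moreover have "a * x + b * x = x" for x
    using ab(3) by (metis distrib_right mult_1)
  ultimately show "a *\<^sub>R X + b *\<^sub>R Y \<in> margin_polytope m n r c"
    using X Y ab(1,2) by (auto simp: margin_polytope_def entry lin)
qed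

text \<open>The map \<open>\<lfloor>x + t\<rfloor>\<close> is monotone and commutes with adding
  integers, so it preserves integral bounds on differences of corner sums as well as integral
  differences.\<close>

lemma rounded_corner_sums_in_margin_sign_matrices:
  assumes X: "X \<in> margin_polytope m n r c" and t: "0 \<le> t" "t < 1"
  shows "mixed_difference m n (\<lambda>i j. real_of_int \<lfloor>corner_sum X i j + t\<rfloor>)
    \<in> margin_sign_matrices m n r c"
proof -
  define F where "F i j = \<lfloor>corner_sum X i j + t\<rfloor>" for i j
  define Y where "Y = mixed_difference m n (\<lambda>i j. real_of_int (F i j))"
  \<comment> \<open>Since \<open>0 \<le> t < 1\<close>, the zero boundary stays zero, which removes
    the boundary terms of the telescoped sums below.\<close>
  have F_0: "F 0 j = 0" "F i 0 = 0" for i j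
    using t by (auto simp: F_def floor_eq_iff)
  have F_add: "F i' j' = F i j + k"
    if "corner_sum X i' j' = corner_sum X i j + of_int k" for i j i' j' k
    unfolding F_def that by linarith
  have col: "(\<Sum>i' = 1..i. entry Y i' j) = real_of_int (F i j - F i (j - 1))"
    if "i \<le> m" "j \<in> {1..n}" for i j
    using mixed_difference_col_sum[OF that] by (simp add: Y_def F_0)
  have row: "(\<Sum>j' = 1..j. entry Y i j') = real_of_int (F i j - F (i - 1) j)"
    if "i \<in> {1..m}" "j \<le> n" for i j
    using mixed_difference_row_sum[OF that] by (simp add: Y_def F_0)
  have S_row: "corner_sum X i j = corner_sum X (i - 1) j + (\<Sum>j' = 1..j. entry X i j')"
    if "i \<in> {1..m}" for i j
    using that corner_sum_Suc_row[of X "i - 1" j] by simp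
  have S_col: "corner_sum X i j = corner_sum X i (j - 1) + (\<Sum>i' = 1..i. entry X i' j)"
    if "j \<in> {1..n}" for i j
    using that corner_sum_Suc_col[of X i "j - 1"] by simp
  have F_col: "F i j - F i (j - 1) \<in> {0, 1}" if "i \<le> m" "j \<in> {1..n}" for i j
  \<comment> \<open>Row 0 is included because the entries in row 1 refer to it; the polytope
    constrains only rows from 1 on.\<close>
  proof (cases "i = 0")
    case False
    then have "0 \<le> (\<Sum>i' = 1..i. entry X i' j)" "(\<Sum>i' = 1..i. entry X i' j) \<le> 1"
      using X that by (auto simp: margin_polytope_def)
    then have "corner_sum X i (j - 1) \<le> corner_sum X i j"
        "corner_sum X i j \<le> corner_sum X i (j - 1) + 1"
      using S_col[OF that(2), of i] by auto
    then have "F i (j - 1) \<le> F i j" "F i j \<le> F i (j - 1) + 1"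
      unfolding F_def by linarith+
    then show ?thesis by auto
  qed (simp add: F_0)
  have F_row: "F (i - 1) j \<le> F i j" if "i \<in> {1..m}" "j \<in> {1..n}" for i j
  proof -
    have "0 \<le> (\<Sum>j' = 1..j. entry X i j')" using X that by (auto simp: margin_polytope_def)
    then show ?thesis unfolding F_def using S_row[OF that(1), of j] by (intro floor_mono) auto
  qed
  have entry: "entry Y i j \<in> {-1, 0, 1}" if "i \<in> {1..m}" "j \<in> {1..n}" for i j
  proof -
    \<comment> \<open>The entry is a difference of two column partial sums, each 0 or 1.\<close>
    define k where "k = (F i j - F i (j - 1)) - (F (i - 1) j - F (i - 1) (j - 1))"
    have "entry Y i j = real_of_int k"
      using that by (simp add: Y_def k_def entry_mixed_difference)
    moreover have "k \<in> {-1, 0, 1}"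
      using F_col[of i j] F_col[of "i - 1" j] that by (fastforce simp: k_def)
    ultimately show ?thesis by auto
  qed
  have "Y \<in> sign_matrices m n"
    unfolding sign_matrices_def
  proof (intro CollectI conjI ballI)
    show "Y \<in> matrices m n" by (simp add: Y_def mixed_difference_in_matrices)
    fix i j assume ij: "i \<in> {1..m}" "j \<in> {1..n}"
    show "entry Y i j \<in> {-1, 0, 1}" using entry[OF ij] .
    show "(\<Sum>i' = 1..i. entry Y i' j) \<in> {0, 1}"
      using F_col[of i j] col[of i j] ij by auto
    show "0 \<le> (\<Sum>j' = 1..j. entry Y i j')"
      using F_row[OF ij] row[of i j] ij by auto
  qed
  moreover have "(\<Sum>j = 1..n. entry Y i j) = r i" if "i \<in> {1..m}" for i
  proof -
    have "(\<Sum>j = 1..n. entry X i j) = r i" using X that by (auto simp: margin_polytope_def)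
    \<comment> \<open>At \<open>j = n\<close> the corner sums of rows \<open>i - 1\<close> and
      \<open>i\<close> differ by the integer \<open>r i\<close>, and rounding keeps this
      difference.\<close>
    then show ?thesis
      using row[OF that, of n] S_row[OF that, of n] F_add[of i n "i - 1" n "r i"] by simp
  qed
  moreover have "(\<Sum>i = 1..m. entry Y i j) = c j" if "j \<in> {1..n}" for j
  proof -
    have "(\<Sum>i = 1..m. entry X i j) = c j" using X that by (auto simp: margin_polytope_def)
    then show ?thesis
      using col[of m, OF _ that] S_col[OF that, of m] F_add[of m j m "j - 1" "c j"] by simp
  qed
  ultimately show ?thesis by (simp add: margin_sign_matrices_def Y_def F_def)
qed

theorem convex_hull_margin_sign_matrices:
  "convex hull margin_sign_matrices m n r c = margin_polytope m n r c"
proof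
  have "margin_sign_matrices m n r c \<subseteq> margin_polytope m n r c"
    by (fastforce simp: margin_sign_matrices_def margin_polytope_def sign_matrices_def)
  then show "convex hull margin_sign_matrices m n r c \<subseteq> margin_polytope m n r c"
    by (intro hull_minimal convex_margin_polytope)
next
  show "margin_polytope m n r c \<subseteq> convex hull margin_sign_matrices m n r c"
  proof
    fix X assume X: "X \<in> margin_polytope m n r c"
    \<comment> \<open>All corner sums, boundary included, are treated at once, so that the same
      shifts and weights serve every position.\<close>
    have "finite ((\<lambda>(i, j). corner_sum X i j) ` ({..m} \<times> {..n}))" by simp
    from ex_rounding_weights[OF this] obtain T w where T: "finite T" "T \<subseteq> {0..<1}"
      and w: "\<And>t. t \<in> T \<Longrightarrow> 0 \<le> w t" "sum w T = 1"
      and avg: "\<And>x. x \<in> (\<lambda>(i, j). corner_sum X i j) ` ({..m} \<times> {..n}) \<Longrightarrow>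
        (\<Sum>t\<in>T. w t * real_of_int \<lfloor>x + t\<rfloor>) = x"
      by blast
    have avg: "(\<Sum>t\<in>T. w t * real_of_int \<lfloor>corner_sum X i j + t\<rfloor>) = corner_sum X i j"
      if "i \<le> m" "j \<le> n" for i j
      using that by (intro avg) auto
    define F where "F t i j = real_of_int \<lfloor>corner_sum X i j + t\<rfloor>" for t i j
    have "X = mixed_difference m n (corner_sum X)"
      using X by (simp add: mixed_difference_corner_sum margin_polytope_def)
    also have "\<dots> = mixed_difference m n (\<lambda>i j. \<Sum>t\<in>T. w t * F t i j)"
      \<comment> \<open>The mixed difference reads only positions in
        \<open>{..m} \<times> {..n}\<close>, where the averages agree with the corner sums.\<close>
      by (rule poly_mapping_eqI) (auto simp: F_def entry_mixed_difference avg)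
    also have "\<dots> = (\<Sum>t\<in>T. w t *\<^sub>R mixed_difference m n (F t))"
      by (rule mixed_difference_sum)
    also have "\<dots> \<in> convex hull margin_sign_matrices m n r c"
    proof (rule convex_sum[OF T(1) convex_convex_hull w(2) w(1)])
      fix t assume "t \<in> T"
      then have "0 \<le> t" "t < 1" using T(2) by auto
      from rounded_corner_sums_in_margin_sign_matrices[OF X this]
      show "mixed_difference m n (F t) \<in> convex hull margin_sign_matrices m n r c"
        unfolding F_def by (rule hull_inc)
    qed
    finally show "X \<in> convex hull margin_sign_matrices m n r c" .
  qed
qed

section \<open>Specialisation to the margins given by a partition and a column vector\<close>

theorem theorem9p8:
  fixes lam v :: "nat list" and n :: nat
  assumes "is_partition lam"
    and "n \<ge> 1"
    and "sorted_wrt (<) v"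
    and "length v = length lam"
    and "set v \<subseteq> {1..n}"
  shows "column_polytope v lam n =
    {X \<in> matrices (first_part lam) n.
      (\<forall>i \<in> {1..first_part lam}. \<forall>j \<in> {1..n}.
         0 \<le> (\<Sum>i' = 1..i. entry X i' j) \<and> (\<Sum>i' = 1..i. entry X i' j) \<le> 1) \<and>
      (\<forall>i \<in> {1..first_part lam}. \<forall>j \<in> {1..n}.
         0 \<le> (\<Sum>j' = 1..j. entry X i j')) \<and>
      (\<forall>i \<in> {1..first_part lam}.
         (\<Sum>j' = 1..n. entry X i j') = real (freq lam (first_part lam - i + 1))) \<and>
      (\<forall>j \<in> {1..n}.
         (\<Sum>i' = 1..first_part lam. entry X i' j) = (if j \<in> set v then 1 else 0))}"
proof -
  define m where "m = first_part lam"
  \<comment> \<open>Frequencies and column indicators are integers, so they are admissible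
    margins.\<close>
  define r where "r i = int (freq lam (m - i + 1))" for i
  define c :: "nat \<Rightarrow> int" where "c j = (if j \<in> set v then 1 else 0)" for j
  have c: "real_of_int (c j) = (if j \<in> set v then 1 else 0)" for j by (simp add: c_def)
  have "column_sign_matrices v lam n = margin_sign_matrices m n r c"
    by (auto simp: column_sign_matrices_def partition_sign_matrices_def
        margin_sign_matrices_def m_def r_def c)
  then have "column_polytope v lam n = margin_polytope m n r c"
    by (simp add: column_polytope_def convex_hull_margin_sign_matrices)
  then show ?thesis by (simp add: margin_polytope_def m_def r_def c)
qed

end
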